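(* Any pair of elements $a$ and $b$ from an $\omega$-complete effect monoid $M$ has an infimum $a\wedge b$, given by $$a\wedge b = \sum_{n=1}^\infty a_n\cdot b_n \quad\text{where}\quad a_1=a,\ b_1=b,\ a_{n+1}=a_n\cdot b_n^\perp,\ b_{n+1}=a_n^\perp\cdot b_n.$$ Consequently, any pair also has a supremum given by $a\vee b=(a^\perp\wedge b^\perp)^\perp$.
   Context: An effect algebra is a set $E$ with an element $0$, a partial binary operation $a+b$ (the partial sum), and a total complement $a\mapsto a^\perp$, such that: the sum is commutative and associative wherever defined, $a+0=a$, $a^\perp$ is the unique element with $a+a^\perp=1$ where $1:=0^\perp$, and $a+1$ defined implies $a=0$. The order is $a\le b$ iff $b=a+c$ for some $c$. An effect monoid is an effect algebra with an associative total multiplication $\cdot$ with unit $1$ which distributes over the partial sum on both sides. It is $\omega$-complete if every increasing sequence has a supremum. For a family $(x_i)_{i\in I}$, the sum $\sum_{i\in I}x_i$ exists if every finite partial sum $\sum_{i\in S}x_i$ ($S\subseteq I$ finite) is defined and the supremum of these finite partial sums exists; the sum is then that supremum. *)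

theory Defs
  imports Main
begin

text \<open>
  The carrier of an effect algebra is the whole type. The partial sum takes values in the option
  type: \<open>s a b = Some c\<close> means that \<open>a + b\<close> is defined and equal to \<open>c\<close>, and \<open>None\<close> means that it is
  undefined.
\<close>

locale effect_algebra =
  fixes psum :: "'a \<Rightarrow> 'a \<Rightarrow> 'a option"
    and zero :: 'a
    and compl :: "'a \<Rightarrow> 'a"
  assumes psum_commute: "psum a b = psum b a"
    and psum_assoc:
      "psum b c = Some d \<Longrightarrow> psum a d = Some e \<Longrightarrow> \<exists>f. psum a b = Some f \<and> psum f c = Some e"
    and psum_zero: "psum a zero = Some a"
    and psum_compl: "psum a b = Some (compl zero) \<longleftrightarrow> b = compl a"
    and psum_one: "psum a (compl zero) \<noteq> None \<Longrightarrow> a = zero"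

definition ea_le :: "('a \<Rightarrow> 'a \<Rightarrow> 'a option) \<Rightarrow> 'a \<Rightarrow> 'a \<Rightarrow> bool"
  where "ea_le psum a b \<longleftrightarrow> (\<exists>c. psum a c = Some b)"

locale effect_monoid = effect_algebra psum zero compl
  for psum :: "'a \<Rightarrow> 'a \<Rightarrow> 'a option" and zero :: 'a and compl :: "'a \<Rightarrow> 'a" +
  fixes mult :: "'a \<Rightarrow> 'a \<Rightarrow> 'a"
  assumes mult_assoc: "mult (mult a b) c = mult a (mult b c)"
    and mult_one_left: "mult (compl zero) a = a"
    and mult_one_right: "mult a (compl zero) = a"
    and distrib_left: "psum b c = Some d \<Longrightarrow> psum (mult a b) (mult a c) = Some (mult a d)"
    and distrib_right: "psum a b = Some d \<Longrightarrow> psum (mult a c) (mult b c) = Some (mult d c)"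

definition is_sup :: "('a \<Rightarrow> 'a \<Rightarrow> bool) \<Rightarrow> 'a set \<Rightarrow> 'a \<Rightarrow> bool"
  where "is_sup le A s \<longleftrightarrow> (\<forall>x\<in>A. le x s) \<and> (\<forall>u. (\<forall>x\<in>A. le x u) \<longrightarrow> le s u)"

definition is_inf :: "('a \<Rightarrow> 'a \<Rightarrow> bool) \<Rightarrow> 'a set \<Rightarrow> 'a \<Rightarrow> bool"
  where "is_inf le A i \<longleftrightarrow> (\<forall>x\<in>A. le i x) \<and> (\<forall>l. (\<forall>x\<in>A. le l x) \<longrightarrow> le l i)"

locale omega_complete_effect_monoid = effect_monoid psum zero compl mult
  for psum :: "'a \<Rightarrow> 'a \<Rightarrow> 'a option" and zero :: 'a and compl :: "'a \<Rightarrow> 'a"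
    and mult :: "'a \<Rightarrow> 'a \<Rightarrow> 'a" +
  assumes omega_complete:
    "(\<And>n :: nat. ea_le psum (x n) (x (Suc n))) \<Longrightarrow> \<exists>s. is_sup (ea_le psum) (range x) s"

definition lift_psum :: "('a \<Rightarrow> 'a \<Rightarrow> 'a option) \<Rightarrow> 'a option \<Rightarrow> 'a option \<Rightarrow> 'a option"
  where "lift_psum psum x y = Option.bind x (\<lambda>a. Option.bind y (psum a))"

text \<open>
  The sum of a finite family, \<open>None\<close> if it is undefined. The lifted sum is strict in \<open>None\<close>, so it is
  a commutative monoid operation on the option type, as shown below, and the library's big operator
  for commutative monoids applies. Only its values on finite index sets are meaningful.
\<close>

definition fin_psum ::
    "('a \<Rightarrow> 'a \<Rightarrow> 'a option) \<Rightarrow> 'a \<Rightarrow> ('i \<Rightarrow> 'a) \<Rightarrow> 'i set \<Rightarrow> 'a option"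
  where "fin_psum psum zero f S =
    comm_monoid_set.F (lift_psum psum) (Some zero) (\<lambda>i. Some (f i)) S"

definition has_psum ::
    "('a \<Rightarrow> 'a \<Rightarrow> 'a option) \<Rightarrow> 'a \<Rightarrow> ('i \<Rightarrow> 'a) \<Rightarrow> 'i set \<Rightarrow> 'a \<Rightarrow> bool"
  where "has_psum psum zero f I s \<longleftrightarrow>
    (\<forall>S. finite S \<and> S \<subseteq> I \<longrightarrow> fin_psum psum zero f S \<noteq> None) \<and>
    is_sup (ea_le psum) {t. \<exists>S. finite S \<and> S \<subseteq> I \<and> fin_psum psum zero f S = Some t} s"

text \<open>
  The two sequences whose termwise products sum to the infimum. They are indexed from \<open>0\<close>, so
  \<open>a\<^sub>1, a\<^sub>2, \<dots>\<close> are the values at \<open>0, 1, \<dots>\<close>.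
\<close>

fun inf_seq_left inf_seq_right ::
    "('a \<Rightarrow> 'a) \<Rightarrow> ('a \<Rightarrow> 'a \<Rightarrow> 'a) \<Rightarrow> 'a \<Rightarrow> 'a \<Rightarrow> nat \<Rightarrow> 'a"
  where
    "inf_seq_left compl mult a b 0 = a"
  | "inf_seq_left compl mult a b (Suc n) =
      mult (inf_seq_left compl mult a b n) (compl (inf_seq_right compl mult a b n))"
  | "inf_seq_right compl mult a b 0 = b"
  | "inf_seq_right compl mult a b (Suc n) =
      mult (compl (inf_seq_left compl mult a b n)) (inf_seq_right compl mult a b n)"

context effect_algebra
begin

lemma psum_assoc':
  assumes "psum a b = Some f" and "psum f c = Some e"
  shows "\<exists>d. psum b c = Some d \<and> psum a d = Some e"
  using assms psum_assoc[of b a f c e] by (metis psum_commute)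

lemma ea_le_refl: "ea_le psum a a"
  unfolding ea_le_def using psum_zero by blast

lemma ea_le_trans: "ea_le psum a b \<Longrightarrow> ea_le psum b c \<Longrightarrow> ea_le psum a c"
  unfolding ea_le_def using psum_assoc' by blast

lemma psum_self_eq:
  assumes "psum a e = Some a"
  shows "e = zero"
proof -
  have "psum e a = Some a" and "psum a (compl a) = Some (compl zero)"
    using assms psum_commute psum_compl by auto
  then show ?thesis
    using psum_assoc' psum_one by (metis option.distinct(1) option.inject)
qed

lemma psum_eq_zero:
  assumes "psum c d = Some zero"
  shows "c = zero"
proof -
  have "psum d c = Some zero" and "psum zero (compl zero) = Some (compl zero)"
    using assms psum_commute psum_compl by auto
  then have "psum c (compl zero) \<noteq> None"
    using psum_assoc'[of d c zero "compl zero" "compl zero"] by auto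
  then show ?thesis
    by (rule psum_one)
qed

lemma ea_le_antisym:
  assumes "ea_le psum a b" and "ea_le psum b a"
  shows "a = b"
proof -
  obtain c d where c: "psum a c = Some b" and d: "psum b d = Some a"
    using assms unfolding ea_le_def by blast
  then obtain e where "psum c d = Some e" and "psum a e = Some a"
    using psum_assoc' by blast
  then have "c = zero"
    using psum_self_eq psum_eq_zero by blast
  then show ?thesis
    using c psum_zero by simp
qed

lemma is_sup_unique: "is_sup (ea_le psum) A s \<Longrightarrow> is_sup (ea_le psum) A t \<Longrightarrow> s = t"
  unfolding is_sup_def using ea_le_antisym by blast

lemma is_inf_unique: "is_inf (ea_le psum) A s \<Longrightarrow> is_inf (ea_le psum) A t \<Longrightarrow> s = t"
  unfolding is_inf_def using ea_le_antisym by blast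

lemma lift_psum_comm_monoid_set: "comm_monoid_set (lift_psum psum) (Some zero)"
proof unfold_locales
  fix x y z :: "'a option"
  have "lift_psum psum (lift_psum psum x y) z = Some e \<longleftrightarrow>
      lift_psum psum x (lift_psum psum y z) = Some e" for e
    by (auto simp: lift_psum_def bind_eq_Some_conv dest: psum_assoc psum_assoc')
  then show "lift_psum psum (lift_psum psum x y) z = lift_psum psum x (lift_psum psum y z)"
    by (metis not_None_eq)
  show "lift_psum psum x y = lift_psum psum y x"
    by (cases x; cases y) (simp_all add: lift_psum_def psum_commute)
  show "lift_psum psum x (Some zero) = x"
    by (cases x) (simp_all add: lift_psum_def psum_zero)
qed

lemma fin_psum_empty: "fin_psum psum zero f {} = Some zero"
  unfolding fin_psum_def by (rule comm_monoid_set.empty[OF lift_psum_comm_monoid_set])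

lemma fin_psum_insert:
  assumes "finite S" and "i \<notin> S"
  shows "fin_psum psum zero f (insert i S) = Option.bind (fin_psum psum zero f S) (psum (f i))"
  using comm_monoid_set.insert[OF lift_psum_comm_monoid_set assms]
  by (simp add: fin_psum_def lift_psum_def)

end

end

theory Submission
  imports Defs
begin

text \<open>
  Let \<open>s\<close> be the supremum of the partial sums \<open>P n = a\<^sub>1 \<cdot> b\<^sub>1 + \<dots> + a\<^sub>n \<cdot> b\<^sub>n\<close>. Since
  \<open>a = P n + a\<^sub>n\<^sub>+\<^sub>1\<close> and \<open>b = P n + b\<^sub>n\<^sub>+\<^sub>1\<close>, we can write \<open>a = s + x\<close> and \<open>b = s + y\<close> with
  \<open>x \<cdot> y \<le> a\<^sub>n \<cdot> b\<^sub>n\<close> for all \<open>n\<close>, and hence \<open>x \<cdot> y = 0\<close>. The element \<open>u\<close>, the supremum of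
  \<open>1 - (1 - x)^n\<close>, satisfies \<open>u \<cdot> y = 0\<close> and \<open>u\<^sup>\<bottom> \<cdot> x = 0\<close>. If \<open>l \<le> a\<close> and \<open>l \<le> b\<close>, then
  \<open>u \<cdot> l \<le> u \<cdot> (s + y) = u \<cdot> s\<close> and \<open>u\<^sup>\<bottom> \<cdot> l \<le> u\<^sup>\<bottom> \<cdot> (s + x) = u\<^sup>\<bottom> \<cdot> s\<close>, and adding the two gives
  \<open>l \<le> s\<close>.
\<close>

section \<open>Order, cancellation and complements in effect algebras\<close>

context effect_algebra
begin

abbreviation le (infix "\<preceq>" 50)
  where "a \<preceq> b \<equiv> ea_le psum a b"

lemma le_psum_left: "psum a b = Some c \<Longrightarrow> a \<preceq> c"
  unfolding ea_le_def by blast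

lemma le_psum_right: "psum a b = Some c \<Longrightarrow> b \<preceq> c"
  using le_psum_left psum_commute by metis

lemma psum_compl_self: "psum a (compl a) = Some (compl zero)"
  using psum_compl by blast

lemma compl_compl: "compl (compl a) = a"
  using psum_compl_self psum_commute psum_compl by metis

lemma psum_zero_left: "psum zero a = Some a"
  using psum_zero psum_commute by metis

text \<open>With \<open>d\<close> the complement of \<open>e\<close>, both \<open>b\<close> and
  \<open>c\<close> complete \<open>a + d\<close> to one, and complements are unique.\<close>

lemma psum_cancel:
  assumes "psum a b = Some e" and "psum a c = Some e"
  shows "b = c"
proof -
  define d where "d = compl e"
  have e: "psum e d = Some (compl zero)"
    unfolding d_def by (rule psum_compl_self)
  obtain f where f: "psum b d = Some f" "psum a f = Some (compl zero)"
    using psum_assoc'[OF assms(1) e] by blast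
  obtain g where g: "psum c d = Some g" "psum a g = Some (compl zero)"
    using psum_assoc'[OF assms(2) e] by blast
  have "f = g"
    using f(2) g(2) psum_compl by simp
  obtain h where h: "psum a d = Some h" "psum h b = Some (compl zero)"
    using psum_assoc[of d b f a "compl zero"] f psum_commute by metis
  obtain k where k: "psum a d = Some k" "psum k c = Some (compl zero)"
    using psum_assoc[of d c g a "compl zero"] g psum_commute by metis
  show ?thesis
    using h k psum_compl by auto
qed

lemma psum_le_cancel:
  assumes "psum c a = Some d" and "psum c b = Some e" and "d \<preceq> e"
  shows "a \<preceq> b"
proof -
  obtain r where "psum d r = Some e"
    using assms(3) unfolding ea_le_def by blast
  then obtain f where f: "psum a r = Some f" "psum c f = Some e"
    using psum_assoc'[OF assms(1)] by blast
  then have "f = b"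
    using psum_cancel assms(2) by blast
  with f(1) show ?thesis
    by (auto intro: le_psum_left)
qed

lemma psum_mono_right:
  assumes "a \<preceq> b" and "psum c b = Some e"
  shows "\<exists>d. psum c a = Some d \<and> d \<preceq> e"
proof -
  obtain r where "psum a r = Some b"
    using assms(1) unfolding ea_le_def by blast
  then show ?thesis
    using psum_assoc[OF _ assms(2)] le_psum_left by blast
qed

lemma psum_mono:
  assumes "a \<preceq> b" and "c \<preceq> d" and "psum b d = Some e" and "psum a c = Some f"
  shows "f \<preceq> e"
proof -
  obtain g where g: "psum b c = Some g" "g \<preceq> e"
    using psum_mono_right assms(2,3) by blast
  obtain h where "psum c a = Some h" "h \<preceq> g"
    using psum_mono_right[OF assms(1), of c g] g(1) psum_commute by metis
  then have "f \<preceq> g"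
    using assms(4) psum_commute by (metis option.inject)
  with g(2) show ?thesis
    using ea_le_trans by blast
qed

text \<open>Writing \<open>s = p + r\<close> and cancelling \<open>p\<close> turns the two
  decompositions into \<open>q = r + x\<close>. When both totals are one, this says that
  complementation reverses the order.\<close>

lemma le_imp_le_remainder:
  assumes "psum p q = Some a" and "psum s x = Some a" and "p \<preceq> s"
  shows "x \<preceq> q"
proof -
  obtain r where "psum p r = Some s"
    using assms(3) unfolding ea_le_def by blast
  then obtain f where f: "psum r x = Some f" "psum p f = Some a"
    using psum_assoc' assms(2) by blast
  then have "f = q"
    using psum_cancel assms(1) by blast
  with f(1) show ?thesis
    by (auto intro: le_psum_right)
qed

lemma compl_antimono: "a \<preceq> b \<Longrightarrow> compl b \<preceq> compl a"
  using le_imp_le_remainder psum_compl_self by blast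

lemma compl_le_iff: "compl a \<preceq> compl b \<longleftrightarrow> b \<preceq> a"
  using compl_antimono compl_compl by metis

lemma le_one: "a \<preceq> compl zero"
  using psum_compl_self le_psum_left by blast

text \<open>Complementation is an order-reversing involution, so it turns the infimum formula into
  the supremum formula.\<close>

lemma is_inf_compl_imp_is_sup:
  assumes "is_inf (\<preceq>) (compl ` A) m"
  shows "is_sup (\<preceq>) A (compl m)"
  unfolding is_sup_def
proof (intro conjI ballI allI impI)
  fix x assume "x \<in> A"
  then show "x \<preceq> compl m"
    using assms unfolding is_inf_def by (metis compl_compl compl_le_iff imageI)
next
  fix u assume "\<forall>x\<in>A. x \<preceq> u"
  then have "compl u \<preceq> m"
    using assms unfolding is_inf_def by (simp add: compl_le_iff)
  then show "compl m \<preceq> u"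
    using compl_antimono compl_compl by metis
qed

text \<open>
  This replaces both the Archimedean property and the continuity of multiplication.
\<close>

lemma psum_below_sup_eq_zero:
  assumes sup: "is_sup (\<preceq>) (range P) s"
    and below: "\<And>n :: nat. \<exists>t. psum z (P n) = Some t \<and> t \<preceq> s"
  shows "z = zero"
proof -
  have "z \<preceq> s"
    using below[of 0] le_psum_left ea_le_trans by blast
  then obtain w where w: "psum z w = Some s"
    unfolding ea_le_def by blast
  \<comment> \<open>Cancel \<open>z\<close> in \<open>z + P n \<le> s = z + w\<close>. Thus
    \<open>w\<close> bounds every \<open>P n\<close>, which forces \<open>w = s\<close> and then
    \<open>z + s = s\<close>.\<close>
  have "P n \<preceq> w" for n
    using below psum_le_cancel w by blast
  then have "s \<preceq> w"
    using sup unfolding is_sup_def by blast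
  then have "w = s"
    using le_psum_right[OF w] ea_le_antisym by blast
  then show ?thesis
    using w psum_self_eq psum_commute by metis
qed

section \<open>Sums of sequences as suprema of initial sums\<close>

lemma fin_psum_subset:
  assumes "finite T" and "S \<subseteq> T" and "fin_psum psum zero f T = Some t"
  shows "\<exists>r. fin_psum psum zero f S = Some r \<and> r \<preceq> t"
  using assms
proof (induction T arbitrary: S t rule: finite_induct)
  case empty
  then show ?case
    using ea_le_refl by auto
next
  case (insert i T)
  then obtain q where q: "fin_psum psum zero f T = Some q" "psum (f i) q = Some t"
    by (auto simp: fin_psum_insert bind_eq_Some_conv)
  \<comment> \<open>Removing \<open>i\<close> makes the induction hypothesis applicable whether or
    not \<open>i\<close> lies in \<open>S\<close>.\<close>
  have "S - {i} \<subseteq> T"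
    using insert.prems by blast
  then obtain r where r: "fin_psum psum zero f (S - {i}) = Some r" "r \<preceq> q"
    using insert.IH q(1) by blast
  show ?case
  proof (cases "i \<in> S")
    case True
    have "finite (S - {i})"
      using insert.hyps insert.prems finite_subset by blast
    then have "fin_psum psum zero f S = psum (f i) r"
      using fin_psum_insert[of "S - {i}" i f] r(1) True by (simp add: insert_absorb)
    then show ?thesis
      using psum_mono_right[OF r(2) q(2)] by simp
  next
    case False
    then show ?thesis
      using r q(2) le_psum_right ea_le_trans by fastforce
  qed
qed

text \<open>Every finite set of indices lies in an initial segment, so the initial sums
  \<open>P n\<close> are cofinal among all finite sums and have the same supremum.\<close>

lemma has_psum_nat:
  assumes P0: "P 0 = zero"
    and P_Suc: "\<And>n. psum (P n) (f n) = Some (P (Suc n))"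
    and sup: "is_sup (\<preceq>) (range P) s"
  shows "has_psum psum zero f (UNIV :: nat set) s"
proof -
  have P: "fin_psum psum zero f {..<n} = Some (P n)" for n
  proof (induction n)
    case 0
    then show ?case
      by (simp add: P0 fin_psum_empty)
  next
    case (Suc n)
    then show ?case
      using P_Suc[of n] by (simp add: lessThan_Suc fin_psum_insert psum_commute)
  qed
  have bounded: "\<exists>r n. fin_psum psum zero f S = Some r \<and> r \<preceq> P n" if S: "finite S" for S
  proof -
    obtain n where "S \<subseteq> {..<n}"
      using S unfolding finite_nat_set_iff_bounded by blast
    then show ?thesis
      using fin_psum_subset[OF _ _ P] by blast
  qed
  have le_s: "P n \<preceq> s" for n
    using sup unfolding is_sup_def by blast
  show ?thesis
    unfolding has_psum_def is_sup_def
  proof (intro conjI allI impI ballI)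
    fix S :: "nat set" assume "finite S \<and> S \<subseteq> UNIV"
    then show "fin_psum psum zero f S \<noteq> None"
      using bounded by fastforce
  next
    fix t assume "t \<in> {t. \<exists>S. finite S \<and> S \<subseteq> UNIV \<and> fin_psum psum zero f S = Some t}"
    then obtain S where "finite S" "fin_psum psum zero f S = Some t"
      by blast
    then obtain n where "t \<preceq> P n"
      using bounded by fastforce
    then show "t \<preceq> s"
      using le_s ea_le_trans by blast
  next
    fix u
    assume "\<forall>t\<in>{t. \<exists>S. finite S \<and> S \<subseteq> UNIV \<and> fin_psum psum zero f S = Some t}. t \<preceq> u"
    then have "P n \<preceq> u" for n
      using P[of n] by blast
    then show "s \<preceq> u"
      using sup unfolding is_sup_def by blast
  qed
qed

end

section \<open>Multiplication in effect monoids\<close>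

context effect_monoid
begin

lemma mult_mono_left:
  assumes "a \<preceq> b"
  shows "mult c a \<preceq> mult c b"
  using assms distrib_left unfolding ea_le_def by blast

lemma mult_mono_right:
  assumes "a \<preceq> b"
  shows "mult a c \<preceq> mult b c"
  using assms distrib_right unfolding ea_le_def by blast

lemma mult_mono: "a \<preceq> b \<Longrightarrow> c \<preceq> d \<Longrightarrow> mult a c \<preceq> mult b d"
  using mult_mono_left mult_mono_right ea_le_trans by blast

lemma mult_le_left: "mult a b \<preceq> a"
  using mult_mono_left[OF le_one] mult_one_right by metis

lemma mult_zero_right: "mult a zero = zero"
  using distrib_left[OF psum_zero] psum_self_eq by blast

lemma mult_zero_left: "mult zero a = zero"
  using distrib_right[OF psum_zero] psum_self_eq by blast

text \<open>Distribute over \<open>b + compl b = 1\<close>. Here and in the left-handed version, the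
  two parts are the term of the infimum series and the next member of the recursion.\<close>

lemma mult_split_right: "psum (mult a b) (mult a (compl b)) = Some a"
  using distrib_left[OF psum_compl_self] mult_one_right by metis

lemma mult_split_left: "psum (mult b a) (mult (compl b) a) = Some a"
  using distrib_right[OF psum_compl_self] mult_one_left by metis

lemma le_of_separation:
  assumes a: "psum s x = Some a" and b: "psum s y = Some b"
    and u: "mult u y = zero" "mult (compl u) x = zero"
    and l: "l \<preceq> a" "l \<preceq> b"
  shows "l \<preceq> s"
proof -
  have "mult u b = mult u s"
    using distrib_left[OF b, of u] u(1) psum_zero by simp
  moreover have "mult (compl u) a = mult (compl u) s"
    using distrib_left[OF a, of "compl u"] u(2) psum_zero by simp
  ultimately have "mult u l \<preceq> mult u s" and "mult (compl u) l \<preceq> mult (compl u) s"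
    using mult_mono_left l by metis+
  then show ?thesis
    using psum_mono mult_split_left by blast
qed

end

section \<open>Separating elements and infima under \<omega>-completeness\<close>

context omega_complete_effect_monoid
begin

lemma separating_element:
  assumes "mult x y = zero"
  obtains u where "mult u y = zero" and "mult (compl u) x = zero"
proof -
  \<comment> \<open>\<open>q n\<close> is the \<open>n\<close>-th power of \<open>compl x\<close>.
    Its complement \<open>v n\<close> grows by \<open>q n * x\<close> at each step, an increment
    that annihilates \<open>y\<close> on the right.\<close>
  define q where "q n = ((\<lambda>r. mult r (compl x)) ^^ n) (compl zero)" for n
  define v where "v n = compl (q n)" for n
  have q_split: "psum (mult (q n) x) (q (Suc n)) = Some (q n)" for n
    unfolding q_def by (simp add: mult_split_right)
  have v_Suc: "psum (v n) (mult (q n) x) = Some (v (Suc n))" for n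
  proof -
    have "psum (v n) (q n) = Some (compl zero)"
      unfolding v_def using psum_compl_self psum_commute by metis
    then obtain d where "psum (v n) (mult (q n) x) = Some d" "psum d (q (Suc n)) = Some (compl zero)"
      using psum_assoc[OF q_split] by blast
    then show ?thesis
      unfolding v_def using psum_commute psum_compl by metis
  qed
  have "\<exists>u. is_sup (\<preceq>) (range v) u"
    by (rule omega_complete) (rule le_psum_left[OF v_Suc])
  then obtain u where sup: "is_sup (\<preceq>) (range v) u" ..
  have v_le: "v n \<preceq> u" for n
    using sup unfolding is_sup_def by blast
  have v_y: "mult (v n) y = zero" for n
  proof (induction n)
    case 0
    have "v 0 = zero"
      unfolding v_def q_def by (simp add: compl_compl)
    then show ?case
      by (simp add: mult_zero_left)
  next
    case (Suc n)
    have "mult (mult (q n) x) y = zero"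
      by (simp add: mult_assoc assms mult_zero_right)
    then show ?case
      using distrib_right[OF v_Suc, of n y] Suc psum_zero by simp
  qed
  have "mult u y = zero"
  proof (rule psum_below_sup_eq_zero[OF sup])
    fix n
    \<comment> \<open>Since \<open>v n\<close> annihilates \<open>y\<close>, only the remainder
      \<open>e\<close> contributes to \<open>u * y\<close>, so \<open>u * y\<close> fits into the
      gap between \<open>v n\<close> and \<open>u\<close>.\<close>
    obtain e where e: "psum (v n) e = Some u"
      using v_le unfolding ea_le_def by blast
    then have "mult u y = mult e y"
      using distrib_right[OF e, of y] v_y psum_zero_left by simp
    then have "mult u y \<preceq> e"
      using mult_le_left by simp
    then show "\<exists>t. psum (mult u y) (v n) = Some t \<and> t \<preceq> u"
      using psum_mono_right e psum_commute by metis
  qed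
  moreover have "mult (compl u) x = zero"
  proof (rule psum_below_sup_eq_zero[OF sup])
    fix n
    \<comment> \<open>This places \<open>compl u * x\<close> below \<open>q n * x\<close>, the
      increment from \<open>v n\<close> to \<open>v (Suc n)\<close>.\<close>
    have "compl u \<preceq> q n"
      using compl_antimono[OF v_le[of n]] by (simp add: v_def compl_compl)
    then have "mult (compl u) x \<preceq> mult (q n) x"
      by (rule mult_mono_right)
    then obtain t where "psum (v n) (mult (compl u) x) = Some t" "t \<preceq> v (Suc n)"
      using psum_mono_right v_Suc by blast
    then show "\<exists>t. psum (mult (compl u) x) (v n) = Some t \<and> t \<preceq> u"
      using v_le ea_le_trans psum_commute by metis
  qed
  ultimately show ?thesis
    by (rule that)
qed

lemma has_psum_is_inf:
  "\<exists>m. has_psum psum zero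
         (\<lambda>n. mult (inf_seq_left compl mult a b n) (inf_seq_right compl mult a b n)) UNIV m
       \<and> is_inf (\<preceq>) {a, b} m"
proof -
  define A where "A = inf_seq_left compl mult a b"
  define B where "B = inf_seq_right compl mult a b"
  define f where "f n = mult (A n) (B n)" for n
  \<comment> \<open>\<open>P n\<close> sums the first \<open>n\<close> terms, so \<open>A n\<close>
    and \<open>B n\<close>, indexed from zero, are what it leaves of \<open>a\<close> and
    \<open>b\<close>. The use of \<open>the\<close> is justified by \<open>P_Suc\<close>.\<close>
  define P where "P = rec_nat zero (\<lambda>n p. the (psum p (f n)))"
  have A_split: "psum (f n) (A (Suc n)) = Some (A n)" for n
    unfolding f_def A_def B_def by (simp add: mult_split_right)
  have B_split: "psum (f n) (B (Suc n)) = Some (B n)" for n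
    unfolding f_def A_def B_def by (simp add: mult_split_left)
  \<comment> \<open>Regrouping \<open>P n + (f n + c')\<close> gives definedness of the next partial
    sum together with the invariant, for \<open>A\<close> and \<open>B\<close> alike.\<close>
  have step: "psum (P n) (f n) = Some (P (Suc n)) \<and> psum (P (Suc n)) c' = Some d"
    if "psum (f n) c' = Some c" "psum (P n) c = Some d" for n c c' d
    using psum_assoc[OF that] by (auto simp: P_def)
  have PA: "psum (P n) (A n) = Some a" for n
    by (induction n) (simp add: P_def A_def psum_zero_left, use step A_split in blast)
  have PB: "psum (P n) (B n) = Some b" for n
    by (induction n) (simp add: P_def B_def psum_zero_left, use step B_split in blast)
  have P_Suc: "psum (P n) (f n) = Some (P (Suc n))" for n
    using step A_split PA by blast
  have "\<exists>s. is_sup (\<preceq>) (range P) s"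
    by (rule omega_complete) (rule le_psum_left[OF P_Suc])
  then obtain s where sup: "is_sup (\<preceq>) (range P) s" ..
  have P_le: "P n \<preceq> s" for n
    using sup unfolding is_sup_def by blast
  have s_le: "s \<preceq> a" "s \<preceq> b"
    using sup le_psum_left PA PB unfolding is_sup_def by blast+
  then obtain x y where x: "psum s x = Some a" and y: "psum s y = Some b"
    unfolding ea_le_def by blast
  have "mult x y = zero"
  proof (rule psum_below_sup_eq_zero[OF sup])
    fix n
    \<comment> \<open>The larger part \<open>s\<close> leaves smaller remainders than
      \<open>P n\<close> does. Hence \<open>x * y\<close> lies below \<open>f n\<close>, the next
      increment of \<open>P\<close>.\<close>
    have "x \<preceq> A n" and "y \<preceq> B n"
      using le_imp_le_remainder PA PB x y P_le by blast+
    then have "mult x y \<preceq> f n"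
      unfolding f_def by (rule mult_mono)
    then obtain t where "psum (P n) (mult x y) = Some t" "t \<preceq> P (Suc n)"
      using psum_mono_right P_Suc by blast
    then show "\<exists>t. psum (mult x y) (P n) = Some t \<and> t \<preceq> s"
      using P_le ea_le_trans psum_commute by metis
  qed
  then obtain u where "mult u y = zero" "mult (compl u) x = zero"
    by (rule separating_element)
  then have "l \<preceq> s" if "l \<preceq> a" "l \<preceq> b" for l
    using le_of_separation[OF x y] that by blast
  then have "is_inf (\<preceq>) {a, b} s"
    using s_le unfolding is_inf_def by simp
  moreover have "has_psum psum zero f UNIV s"
    using has_psum_nat[of P f s] P_Suc sup by (simp add: P_def)
  ultimately show ?thesis
    unfolding f_def A_def B_def by blast
qed

end

theorem theorem37:
  fixes psum :: "'a \<Rightarrow> 'a \<Rightarrow> 'a option"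
    and zero :: 'a
    and compl :: "'a \<Rightarrow> 'a"
    and mult :: "'a \<Rightarrow> 'a \<Rightarrow> 'a"
    and a b :: 'a
  assumes "omega_complete_effect_monoid psum zero compl mult"
  shows "(\<exists>m. has_psum psum zero
              (\<lambda>n. mult (inf_seq_left compl mult a b n) (inf_seq_right compl mult a b n)) UNIV m
            \<and> is_inf (ea_le psum) {a, b} m)
       \<and> (\<exists>m. is_inf (ea_le psum) {compl a, compl b} m
            \<and> is_sup (ea_le psum) {a, b} (compl m))"
proof -
  interpret omega_complete_effect_monoid psum zero compl mult
    by (rule assms)
  \<comment> \<open>The infimum result is applied to the complements here and to \<open>a\<close>
    and \<open>b\<close> themselves at the end.\<close>
  obtain m where m: "is_inf (ea_le psum) {compl a, compl b} m"
    using has_psum_is_inf by blast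
  then have "is_sup (ea_le psum) {a, b} (compl m)"
    by (intro is_inf_compl_imp_is_sup) simp
  with m show ?thesis
    using has_psum_is_inf by blast
qed

end
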